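(* Let $G$ be a directed graph, $k$ a positive integer, and $H$ a subgraph of $G$. Then $H$ is an (all-pairs) $k$-connectivity preserver of $G$, i.e. $\lambda^k_H(s,t)=\lambda^k_G(s,t)$ for all $s,t\in V(G)$, if and only if for every $s,t\in V(G)$ and every minimal symmetric $(s,t)$-cut $(S,V-S)$ in $G$ we have $|\delta^+_H(S)|\ge\lambda^k_G(s,t)$.
   Context: $V=V(G)$; a subgraph $H$ has $V(H)=V$, $E(H)\subseteq E(G)$. $\mathrm{flow}(G,s,t)$ is the maximum number of edge-disjoint $s$-to-$t$ paths; $\lambda_G(s,t)=\min(\mathrm{flow}(G,s,t),\mathrm{flow}(G,t,s))$, $\lambda^k_G(s,t)=\min(\lambda_G(s,t),k)$. For a cut $(S,V-S)$, $\delta^+_G(S)$ is the set of edges of $G$ from $S$ to $V-S$. An $(s,t)$-cut has $s\in S$, $t\in V-S$. An $(s,t)$-cut $(S,V-S)$ in $G$ is a minimal symmetric $(s,t)$-cut if there is no cut $(S',V-S')$ with $\delta^+_G(S')\subsetneq\delta^+_G(S)$ that is an $(s,t)$-cut or a $(t,s)$-cut. *)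

theory Defs
  imports "Graph_Theory.Graph_Theory"
begin

text \<open>
  Families of edge-disjoint paths are sets of arc lists, so for \<open>s = t\<close> the only path is the
  empty one and the value is 1 in every graph containing \<open>s\<close>.  The maximum is over a finite
  nonempty set whenever \<open>G\<close> is finite.
\<close>
definition flow :: "('a, 'b) pre_digraph \<Rightarrow> 'a \<Rightarrow> 'a \<Rightarrow> nat" where
  "flow G s t = Max {card P | P.
     finite P \<and> (\<forall>p \<in> P. pre_digraph.apath G s p t) \<and>
     pairwise (\<lambda>p q. set p \<inter> set q = {}) P}"

definition sym_conn :: "('a, 'b) pre_digraph \<Rightarrow> 'a \<Rightarrow> 'a \<Rightarrow> nat" where
  "sym_conn G s t = min (flow G s t) (flow G t s)"

definition sym_conn_upto :: "nat \<Rightarrow> ('a, 'b) pre_digraph \<Rightarrow> 'a \<Rightarrow> 'a \<Rightarrow> nat" where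
  "sym_conn_upto k G s t = min (sym_conn G s t) k"

definition connectivity_preserver ::
    "nat \<Rightarrow> ('a, 'b) pre_digraph \<Rightarrow> ('a, 'b) pre_digraph \<Rightarrow> bool" where
  "connectivity_preserver k H G \<longleftrightarrow>
     (\<forall>s \<in> verts G. \<forall>t \<in> verts G. sym_conn_upto k H s t = sym_conn_upto k G s t)"

definition out_cut :: "('a, 'b) pre_digraph \<Rightarrow> 'a set \<Rightarrow> 'b set" where
  "out_cut G S = {e \<in> arcs G. tail G e \<in> S \<and> head G e \<in> verts G - S}"

definition st_cut :: "('a, 'b) pre_digraph \<Rightarrow> 'a \<Rightarrow> 'a \<Rightarrow> 'a set \<Rightarrow> bool" where
  "st_cut G s t S \<longleftrightarrow> S \<subseteq> verts G \<and> s \<in> S \<and> t \<in> verts G - S"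

definition minimal_symmetric_cut :: "('a, 'b) pre_digraph \<Rightarrow> 'a \<Rightarrow> 'a \<Rightarrow> 'a set \<Rightarrow> bool" where
  "minimal_symmetric_cut G s t S \<longleftrightarrow>
     st_cut G s t S \<and>
     \<not> (\<exists>S'. (st_cut G s t S' \<or> st_cut G t s S') \<and> out_cut G S' \<subset> out_cut G S)"

end

theory Submission
  imports Defs
begin

text \<open>
  A cut of \<open>H\<close> whose size is \<open>flow H s t\<close> exists by the directed edge version of Menger's theorem.
  Among the \<open>(s,t)\<close>- and \<open>(t,s)\<close>-cuts whose arc set in \<open>G\<close> is contained in the arc set of that cut,
  one with inclusion-minimal arc set is a minimal symmetric cut, and \<open>\<lambda>\<close> is symmetric in \<open>s\<close>
  and \<open>t\<close>, so the hypothesis bounds \<open>flow H s t\<close> from below.  Conversely, every cut bounds the flow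
  from above.

  Menger's theorem is obtained from a maximum \<open>0\<close>-\<open>1\<close> flow, that is, a set of arcs whose excess
  vanishes away from \<open>s\<close> and \<open>t\<close>.  The residual digraph is \<open>G\<close> with the arcs of the flow reversed;
  the vertices reachable from \<open>s\<close> in it form the cut.
\<close>

section \<open>Excess of arc sets\<close>

text \<open>Net outflow at \<open>v\<close> of the 0-1 flow supported on \<open>F\<close>. One
  integer sum over arcs, rather than a difference of two degrees, lets set operations on
  \<open>F\<close> act through the rules for sums; a loop contributes 0.\<close>

definition excess :: "('a, 'b) pre_digraph \<Rightarrow> 'b set \<Rightarrow> 'a \<Rightarrow> int" where
  "excess G F v = (\<Sum>a\<in>F. of_bool (tail G a = v) - of_bool (head G a = v))"

lemma excess_update_arcs [simp]: "excess (G\<lparr>arcs := A\<rparr>) = excess G"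
  by (simp add: excess_def fun_eq_iff)

lemma excess_Diff:
  assumes "finite F" "E \<subseteq> F"
  shows "excess G (F - E) v = excess G F v - excess G E v"
  using assms by (simp add: excess_def sum_diff)

text \<open>Swapping the two sums leaves one term per arc, which cancels unless exactly one end lies
  in \<open>R\<close>.\<close>

lemma sum_excess:
  assumes "finite F" "finite R"
  shows "(\<Sum>v\<in>R. excess G F v) =
    int (card {a \<in> F. tail G a \<in> R \<and> head G a \<notin> R}) -
    int (card {a \<in> F. tail G a \<notin> R \<and> head G a \<in> R})"
proof -
  have card_eq: "int (card {a \<in> F. Q a}) = (\<Sum>a\<in>F. of_bool (Q a))" for Q
    using assms(1) by (simp add: Int_def)
  have "(\<Sum>v\<in>R. excess G F v) =
      (\<Sum>a\<in>F. \<Sum>v\<in>R. of_bool (tail G a = v) - of_bool (head G a = v))"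
    unfolding excess_def by (rule sum.swap)
  also have "\<dots> = (\<Sum>a\<in>F. of_bool (tail G a \<in> R) - of_bool (head G a \<in> R))"
    using assms(2) by (simp add: sum_subtractf of_bool_def)
  also have "\<dots> = (\<Sum>a\<in>F. of_bool (tail G a \<in> R \<and> head G a \<notin> R) -
      of_bool (tail G a \<notin> R \<and> head G a \<in> R))"
    by (intro sum.cong) auto
  finally show ?thesis
    by (simp only: card_eq sum_subtractf)
qed

lemma sum_excess_eq_source:
  assumes "finite R" "s \<in> R" "t \<notin> R"
    and "\<And>v. v \<in> R - {s, t} \<Longrightarrow> excess G F v = 0"
  shows "(\<Sum>v\<in>R. excess G F v) = excess G F s"
  using assms by (subst sum.remove[of R s]) (auto intro!: sum.neutral)

text \<open>The vertices of a path are distinct, hence so are its arcs; the sum over the arc set is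
  then a sum along the list, and it telescopes.\<close>

lemma (in wf_digraph) excess_apath:
  assumes "apath u p w"
  shows "excess G (set p) v = of_bool (u = v) - of_bool (w = v)"
proof -
  have "distinct p"
    using assms by (auto simp: apath_def intro: distinct_verts_imp_distinct)
  then have "excess G (set p) v =
      (\<Sum>a\<leftarrow>p. of_bool (tail G a = v) - of_bool (head G a = v))"
    by (simp add: excess_def sum_list_distinct_conv_sum_set)
  also have "cas u p w \<Longrightarrow> \<dots> = of_bool (u = v) - of_bool (w = v)"
    by (induction p arbitrary: u) auto
  finally show ?thesis
    using assms by (auto simp: apath_def awalk_def)
qed

section \<open>Menger's theorem for arcs\<close>

text \<open>No arc leaves the set of vertices reachable from \<open>s\<close>. This serves twice:
  for the digraph of flow arcs, to extract paths, and for the residual digraph, to find the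
  cut.\<close>

lemma (in wf_digraph) apath_or_empty_out_cut:
  assumes "s \<in> verts G" "t \<in> verts G"
  obtains p where "apath s p t" | S where "st_cut G s t S" "out_cut G S = {}"
proof (cases "s \<rightarrow>\<^sup>* t")
  case True
  then show ?thesis
    using that(1) by (auto simp: reachable_apath)
next
  case False
  let ?S = "{v. s \<rightarrow>\<^sup>* v}"
  have "st_cut G s t ?S"
    using assms False by (auto simp: st_cut_def dest: reachable_in_verts)
  moreover have "out_cut G ?S = {}"
    by (auto simp: out_cut_def) (meson in_arcs_imp_in_arcs_ends reachable_adj_trans)
  ultimately show ?thesis
    using that(2) by blast
qed

lemma fin_digraph_update_arcs:
  assumes "fin_digraph G" "A \<subseteq> arcs G"
  shows "fin_digraph (G\<lparr>arcs := A\<rparr>)"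
proof -
  interpret fin_digraph G by fact
  show ?thesis
    using assms(2) by unfold_locales (auto intro: finite_subset)
qed

lemma apath_update_arcs:
  "pre_digraph.apath (G\<lparr>arcs := A\<rparr>) u p v \<longleftrightarrow>
     u \<in> verts G \<and> set p \<subseteq> A \<and> pre_digraph.cas G u p v \<and>
     distinct (pre_digraph.awalk_verts G u p)"
proof -
  have "compatible (G\<lparr>arcs := A\<rparr>) G"
    by (simp add: compatible_def)
  then show ?thesis
    by (auto simp: pre_digraph.apath_def pre_digraph.awalk_def compatible_cas
        compatible_awalk_verts)
qed

text \<open>Induction on \<open>n\<close>: deleting a path from \<open>s\<close> to \<open>t\<close>
  inside \<open>F\<close> lowers the excess at \<open>s\<close> by one and leaves it 0 away from
  \<open>s\<close> and \<open>t\<close>. Cycles in \<open>F\<close> may remain when \<open>n\<close>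
  reaches 0.\<close>

lemma arc_disjoint_apaths_of_excess:
  assumes "fin_digraph G" "s \<in> verts G" "t \<in> verts G" "s \<noteq> t" "F \<subseteq> arcs G"
    and "\<And>v. v \<in> verts G - {s, t} \<Longrightarrow> excess G F v = 0"
    and "excess G F s = int n"
  shows "\<exists>P. finite P \<and> card P = n \<and> (\<forall>p\<in>P. pre_digraph.apath G s p t \<and> set p \<subseteq> F) \<and>
    pairwise (\<lambda>p q. set p \<inter> set q = {}) P"
  using assms(5-)
proof (induction n arbitrary: F)
  case 0
  show ?case
    by (intro exI[of _ "{}"]) auto
next
  case (Suc n)
  interpret G: fin_digraph G by fact
  interpret F: fin_digraph "G\<lparr>arcs := F\<rparr>"
    using assms(1) Suc.prems(1) by (rule fin_digraph_update_arcs)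
  have fin: "finite F"
    using F.finite_arcs by simp
  obtain p where p: "F.apath s p t"
  proof (rule F.apath_or_empty_out_cut[of s t])
    \<comment> \<open>If no flow arc left \<open>S\<close>, its total excess would be at most 0, yet
      it equals the excess at \<open>s\<close>, which is \<open>Suc n\<close>.\<close>
    fix S assume S: "st_cut (G\<lparr>arcs := F\<rparr>) s t S" "out_cut (G\<lparr>arcs := F\<rparr>) S = {}"
    then have sub: "S \<subseteq> verts G" "s \<in> S" "t \<notin> S" and finS: "finite S"
      by (auto simp: st_cut_def intro: finite_subset[OF _ G.finite_verts])
    have "{a \<in> F. tail G a \<in> S \<and> head G a \<notin> S} = {}"
      using S(2) Suc.prems(1) by (auto simp: out_cut_def)
    then have "(\<Sum>v\<in>S. excess G F v) \<le> 0"
      by (simp add: sum_excess[OF fin finS] del: Collect_empty_eq)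
    moreover have "(\<Sum>v\<in>S. excess G F v) = excess G F s"
      using sub finS Suc.prems(2) by (intro sum_excess_eq_source[where t = t]) auto
    ultimately show ?thesis
      using Suc.prems(3) by simp
  qed (use assms in auto)
  have pF: "set p \<subseteq> F" and pG: "G.apath s p t"
    using p Suc.prems(1) by (auto simp: apath_update_arcs G.apath_def G.awalk_def)
  have "excess G (F - set p) v = excess G F v - of_bool (s = v) + of_bool (t = v)" for v
    using excess_Diff[OF fin pF, of G v] G.excess_apath[OF pG, of v] by simp
  then have "\<And>v. v \<in> verts G - {s, t} \<Longrightarrow> excess G (F - set p) v = 0"
    "excess G (F - set p) s = int n"
    using Suc.prems assms(4) by auto
  then obtain P where P: "finite P" "card P = n"
      "\<And>q. q \<in> P \<Longrightarrow> G.apath s q t" "\<And>q. q \<in> P \<Longrightarrow> set q \<subseteq> F - set p"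
      "pairwise (\<lambda>p q. set p \<inter> set q = {}) P"
    using Suc.IH[of "F - set p"] Suc.prems(1) by blast
  \<comment> \<open>The paths in \<open>P\<close> avoid the arcs of \<open>p\<close>, so a nonempty
    \<open>p\<close> is not among them and inserting it raises the cardinality.\<close>
  have "p \<noteq> []"
    using pG assms(4) by (auto simp: G.apath_Nil_iff)
  then have "p \<notin> P"
    using P(4)[of p] by (cases p) auto
  with P pF pG show ?case
    by (intro exI[of _ "insert p P"]) (fastforce simp: pairwise_insert)
qed

lemma (in fin_digraph) max_flow_eq_cut:
  assumes "s \<in> verts G" "t \<in> verts G" "s \<noteq> t"
  obtains F S where "F \<subseteq> arcs G" "\<And>v. v \<in> verts G - {s, t} \<Longrightarrow> excess G F v = 0"
    "st_cut G s t S" "excess G F s = int (card (out_cut G S))"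
proof -
  define flows where
    "flows = {F. F \<subseteq> arcs G \<and> (\<forall>v\<in>verts G - {s, t}. excess G F v = 0)}"
  have "finite flows" "{} \<in> flows"
    by (auto simp: flows_def excess_def)
  then have "Max ((\<lambda>F. excess G F s) ` flows) \<in> (\<lambda>F. excess G F s) ` flows"
    by (intro Max_in) auto
  then obtain F where F: "F \<in> flows" and "excess G F s = Max ((\<lambda>F. excess G F s) ` flows)"
    by auto
  then have F_max: "\<And>F'. F' \<in> flows \<Longrightarrow> excess G F' s \<le> excess G F s"
    using \<open>finite flows\<close> by simp
  have FG: "F \<subseteq> arcs G" and F0: "\<And>v. v \<in> verts G - {s, t} \<Longrightarrow> excess G F v = 0"
    using F by (auto simp: flows_def)
  have finF: "finite F"
    using FG by (rule finite_subset) simp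
  \<comment> \<open>Arcs keep their names and only swap ends on \<open>F\<close>, so a path in
    \<open>D\<close> is also a set of arcs of \<open>G\<close>.\<close>
  define D where "D = G\<lparr>tail := \<lambda>a. if a \<in> F then head G a else tail G a,
    head := \<lambda>a. if a \<in> F then tail G a else head G a\<rparr>"
  have D_simps: "verts D = verts G" "arcs D = arcs G"
      "tail D a = (if a \<in> F then head G a else tail G a)"
      "head D a = (if a \<in> F then tail G a else head G a)" for a
    by (simp_all add: D_def)
  interpret D: fin_digraph D
    by unfold_locales (auto simp: D_simps)
  have aug: False if p: "D.apath s p t" for p
  proof -
    \<comment> \<open>Augmentation is the symmetric difference: arcs of \<open>p\<close> outside
      \<open>F\<close> are added, and those in \<open>F\<close>, traversed backwards, are cancelled.
      Reversal flips the sign of an excess, so both kinds contribute as in \<open>D\<close>, and the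
      excess at \<open>s\<close> grows by one, against maximality.\<close>
    let ?F = "(F - set p) \<union> (set p - F)"
    have pG: "set p \<subseteq> arcs G"
      using p by (auto simp: D.apath_def D.awalk_def D_simps)
    have ex: "excess G ?F v = excess G F v + of_bool (s = v) - of_bool (t = v)" for v
    proof -
      let ?f = "\<lambda>a. of_bool (tail G a = v) - of_bool (head G a = v) :: int"
      have "excess G ?F v = sum ?f (F - set p) + sum ?f (set p - F)"
        unfolding excess_def using finF by (intro sum.union_disjoint) auto
      also have "sum ?f (F - set p) = excess G F v - sum ?f (set p \<inter> F)"
        using finF sum.Int_Diff[of F ?f "set p"] by (simp add: excess_def Int_commute)
      also have "sum ?f (set p - F) = excess D (set p - F) v"
        by (auto simp: excess_def D_simps intro!: sum.cong)
      also have "sum ?f (set p \<inter> F) = - excess D (set p \<inter> F) v"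
        unfolding excess_def sum_negf[symmetric]
        by (auto simp: D_simps intro!: sum.cong)
      also have "excess G F v - - excess D (set p \<inter> F) v + excess D (set p - F) v =
          excess G F v + excess D (set p) v"
        unfolding excess_def by (subst sum.Int_Diff[of "set p" _ F]) simp_all
      finally show ?thesis
        using D.excess_apath[OF p, of v] by simp
    qed
    then have "?F \<in> flows"
      using F0 FG pG by (auto simp: flows_def)
    from F_max[OF this] ex[of s] assms(3) show False
      by simp
  qed
  obtain S where S: "st_cut D s t S" "out_cut D S = {}"
    using D.apath_or_empty_out_cut[of s t] aug assms by (auto simp: D_simps)
  then have SG: "st_cut G s t S" and sub: "S \<subseteq> verts G" "s \<in> S" "t \<notin> S"
    by (auto simp: st_cut_def D_simps)
  have finS: "finite S"
    using sub(1) by (rule finite_subset) simp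
  \<comment> \<open>For an arc outside \<open>F\<close> this forbids leaving \<open>S\<close>; for
    an arc of \<open>F\<close>, reversed in \<open>D\<close>, it forbids entering \<open>S\<close>.
    So the flow fills the cut and nothing flows back.\<close>
  have closed: "head D a \<in> S" if "a \<in> arcs G" "tail D a \<in> S" for a
    using S(2) that D.head_in_verts[of a] by (auto simp: out_cut_def D_simps(1,2))
  have out: "{a \<in> F. tail G a \<in> S \<and> head G a \<notin> S} = out_cut G S"
    using closed FG sub by (fastforce simp: out_cut_def D_simps split: if_splits)
  have inn: "{a \<in> F. tail G a \<notin> S \<and> head G a \<in> S} = {}"
    using closed FG by (fastforce simp: D_simps split: if_splits)
  have "excess G F s = (\<Sum>v\<in>S. excess G F v)"
    using sub finS F0 by (intro sum_excess_eq_source[where t = t, symmetric]) auto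
  also have "\<dots> = int (card (out_cut G S))"
    unfolding sum_excess[OF finF finS] out inn by simp
  finally show ?thesis
    using that FG F0 SG by blast
qed

section \<open>Families of arc-disjoint paths against cuts, and minimal symmetric cuts\<close>

context fin_digraph
begin

lemma finite_flow_values:
  "finite {card P | P. finite P \<and> (\<forall>p\<in>P. apath s p t) \<and>
     pairwise (\<lambda>p q. set p \<inter> set q = {}) P}" (is "finite ?N")
proof -
  have "?N \<subseteq> card ` Pow {p. apath s p t}"
    by auto
  then show ?thesis
    by (rule finite_subset) (simp add: apaths_finite)
qed

lemma flow_geI:
  assumes "finite P" "\<And>p. p \<in> P \<Longrightarrow> apath s p t" "pairwise (\<lambda>p q. set p \<inter> set q = {}) P"
  shows "card P \<le> flow G s t"
  unfolding flow_def using assms by (intro Max_ge[OF finite_flow_values]) blast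

lemma flow_witness:
  obtains P where "finite P" "\<forall>p\<in>P. apath s p t"
    "pairwise (\<lambda>p q. set p \<inter> set q = {}) P" "card P = flow G s t"
proof -
  have "flow G s t \<in> {card P | P. finite P \<and> (\<forall>p\<in>P. apath s p t) \<and>
     pairwise (\<lambda>p q. set p \<inter> set q = {}) P}"
    unfolding flow_def by (intro Max_in[OF finite_flow_values]) (auto intro!: exI[of _ "{}"])
  then show ?thesis
    using that by auto
qed

lemma awalk_meets_out_cut:
  assumes "awalk s p t" "st_cut G s t S"
  obtains a where "a \<in> set p" "a \<in> out_cut G S"
proof -
  have "\<exists>a\<in>set p. a \<in> out_cut G S" if "awalk u p t" "u \<in> S" for u
    using that
  proof (induction p arbitrary: u)
    case Nil
    then show ?case
      using assms(2) by (auto simp: awalk_Nil_iff st_cut_def)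
  next
    case (Cons a p)
    then show ?case
      by (cases "head G a \<in> S") (auto simp: awalk_Cons_iff out_cut_def)
  qed
  then show ?thesis
    using that assms by (auto simp: st_cut_def)
qed

text \<open>Pick on each path an arc that crosses the cut; since the paths share no arcs, the choice
  is injective.\<close>

lemma flow_le_card_out_cut:
  assumes "st_cut G s t S"
  shows "flow G s t \<le> card (out_cut G S)"
proof -
  obtain P where P: "finite P" "\<forall>p\<in>P. apath s p t"
    "pairwise (\<lambda>p q. set p \<inter> set q = {}) P" "card P = flow G s t"
    using flow_witness[of s t] by blast
  have "\<forall>p\<in>P. \<exists>a. a \<in> set p \<and> a \<in> out_cut G S"
    using P(2) assms by (meson apath_def awalk_meets_out_cut)
  then obtain f where f: "\<And>p. p \<in> P \<Longrightarrow> f p \<in> set p" "\<And>p. p \<in> P \<Longrightarrow> f p \<in> out_cut G S"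
    by metis
  have "inj_on f P"
    using P(3) f(1) by (fastforce simp: inj_on_def pairwise_def)
  moreover have "finite (out_cut G S)"
    by (simp add: out_cut_def)
  ultimately show ?thesis
    using f(2) P(4) by (metis card_inj_on_le image_subsetI)
qed

theorem menger_arcs:
  assumes "s \<in> verts G" "t \<in> verts G" "s \<noteq> t"
  obtains S where "st_cut G s t S" "flow G s t = card (out_cut G S)"
proof -
  obtain F S where F: "F \<subseteq> arcs G" "\<And>v. v \<in> verts G - {s, t} \<Longrightarrow> excess G F v = 0"
    "excess G F s = int (card (out_cut G S))" and S: "st_cut G s t S"
    by (rule max_flow_eq_cut[OF assms]) blast
  obtain P where "finite P" "card P = card (out_cut G S)" "\<And>p. p \<in> P \<Longrightarrow> apath s p t"
    "pairwise (\<lambda>p q. set p \<inter> set q = {}) P"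
    using arc_disjoint_apaths_of_excess[OF fin_digraph_axioms assms F] by blast
  then have "card (out_cut G S) \<le> flow G s t"
    using flow_geI[of P s t] by simp
  with flow_le_card_out_cut[OF S] S that show ?thesis
    by simp
qed

text \<open>Covers the case without any cut, \<open>s = t\<close>: distinctness of vertices leaves
  only the empty path.\<close>

lemma flow_refl:
  assumes "s \<in> verts G"
  shows "flow G s s = 1"
proof (rule antisym)
  obtain P where P: "finite P" "\<forall>p\<in>P. apath s p s" "card P = flow G s s"
    using flow_witness[of s s] by blast
  have "P \<subseteq> {[]}"
  proof
    fix p assume "p \<in> P"
    then have "apath s p s"
      using P(2) by blast
    then show "p \<in> {[]}"
      using apath_nonempty_ends[of s p s] by auto
  qed
  then show "flow G s s \<le> 1"
    using P(3) card_mono[of "{[] :: 'b list}" P] by simp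
  show "1 \<le> flow G s s"
    using flow_geI[of "{[]}" s s] assms by (simp add: apath_Nil_iff)
qed

lemma flow_mono_subgraph:
  assumes "subgraph H G"
  shows "flow H s t \<le> flow G s t"
proof -
  interpret H: fin_digraph H
    using assms by (rule fin_digraph_subgraph)
  obtain P where "finite P" "\<forall>p\<in>P. H.apath s p t"
    "pairwise (\<lambda>p q. set p \<inter> set q = {}) P" "card P = flow H s t"
    using H.flow_witness[of s t] by blast
  then show ?thesis
    using flow_geI[of P s t] subgraph_apath_imp_apath[OF _ assms] by metis
qed

text \<open>Minimality is taken over the finitely many arc sets, since different vertex sets can
  have the same outgoing arcs. Both orientations compete, so the minimal cut may separate
  \<open>t\<close> from \<open>s\<close>.\<close>

lemma minimal_symmetric_cut_below:
  assumes "st_cut G s t S"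
  obtains S' where "minimal_symmetric_cut G s t S' \<or> minimal_symmetric_cut G t s S'"
    "out_cut G S' \<subseteq> out_cut G S"
proof -
  define C where "C = {S'. (st_cut G s t S' \<or> st_cut G t s S') \<and> out_cut G S' \<subseteq> out_cut G S}"
  have "finite (out_cut G ` C)"
    by (rule finite_subset[of _ "Pow (arcs G)"]) (auto simp: out_cut_def)
  moreover have "out_cut G S \<in> out_cut G ` C"
    using assms by (auto simp: C_def)
  ultimately have "\<exists>M \<in> out_cut G ` C. \<forall>B \<in> out_cut G ` C. B \<subseteq> M \<longrightarrow> M = B"
    by (intro finite_has_minimal) auto
  then obtain S' where S': "S' \<in> C"
    and min: "\<forall>S''\<in>C. out_cut G S'' \<subseteq> out_cut G S' \<longrightarrow> out_cut G S' = out_cut G S''"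
    by auto
  have "\<not> out_cut G S'' \<subset> out_cut G S'" if "st_cut G s t S'' \<or> st_cut G t s S''" for S''
    using min S' that by (auto simp: C_def)
  with S' show ?thesis
    by (intro that[of S']) (auto simp: C_def minimal_symmetric_cut_def)
qed

end

lemma sym_conn_upto_commute: "sym_conn_upto k G s t = sym_conn_upto k G t s"
  by (simp add: sym_conn_upto_def sym_conn_def min.commute)

section \<open>Connectivity preservers\<close>

theorem theoremA8:
  fixes G H :: "('a, 'b) pre_digraph" and k :: nat
  assumes "fin_digraph G"
    and "k > 0"
    and "spanning H G"
  shows "connectivity_preserver k H G \<longleftrightarrow>
    (\<forall>s \<in> verts G. \<forall>t \<in> verts G. \<forall>S. minimal_symmetric_cut G s t S \<longrightarrow>
       card (out_cut H S) \<ge> sym_conn_upto k G s t)"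
proof -
  interpret G: fin_digraph G by fact
  have sub: "subgraph H G" and verts: "verts H = verts G"
    using assms(3) by (auto simp: spanning_def)
  interpret H: fin_digraph H
    using sub by (rule G.fin_digraph_subgraph)
  have cut_eq: "st_cut H s t S \<longleftrightarrow> st_cut G s t S" for s t S
    by (simp add: st_cut_def verts)
  have out_eq: "out_cut H S = out_cut G S \<inter> arcs H" for S
    using sub verts by (auto simp: out_cut_def subgraph_def compatible_def)
  show ?thesis
  proof (intro iffI ballI allI impI)
    fix s t S
    assume pres: "connectivity_preserver k H G" and st: "s \<in> verts G" "t \<in> verts G"
      and S: "minimal_symmetric_cut G s t S"
    have "sym_conn_upto k G s t = sym_conn_upto k H s t"
      using pres st by (simp add: connectivity_preserver_def)
    also have "\<dots> \<le> flow H s t"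
      by (simp add: sym_conn_upto_def sym_conn_def)
    also have "\<dots> \<le> card (out_cut H S)"
      using S by (intro H.flow_le_card_out_cut) (simp add: cut_eq minimal_symmetric_cut_def)
    finally show "sym_conn_upto k G s t \<le> card (out_cut H S)" .
  next
    assume *: "\<forall>s\<in>verts G. \<forall>t\<in>verts G. \<forall>S. minimal_symmetric_cut G s t S \<longrightarrow>
      card (out_cut H S) \<ge> sym_conn_upto k G s t"
    \<comment> \<open>Applied to \<open>(s, t)\<close> and to \<open>(t, s)\<close>, this bounds
      both flows whose minimum defines \<open>sym_conn H s t\<close>.\<close>
    have flow_ge: "sym_conn_upto k G s t \<le> flow H s t"
      if st: "s \<in> verts G" "t \<in> verts G" for s t
    proof (cases "s = t")
      case True
      then show ?thesis
        using st by (simp add: sym_conn_upto_def sym_conn_def G.flow_refl H.flow_refl verts)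
    next
      case False
      obtain S where S: "st_cut H s t S" "flow H s t = card (out_cut H S)"
        using H.menger_arcs[of s t] st False by (auto simp: verts)
      obtain S' where S': "minimal_symmetric_cut G s t S' \<or> minimal_symmetric_cut G t s S'"
        "out_cut G S' \<subseteq> out_cut G S"
        using S(1) G.minimal_symmetric_cut_below[of s t S] by (auto simp: cut_eq)
      \<comment> \<open>If \<open>S'\<close> is a \<open>(t, s)\<close>-cut, the hypothesis is used
        with \<open>s\<close> and \<open>t\<close> exchanged.\<close>
      have "sym_conn_upto k G s t \<le> card (out_cut H S')"
        using S'(1) * st by (metis sym_conn_upto_commute)
      \<comment> \<open>The inclusion of cuts in \<open>G\<close> survives intersection with
        \<open>arcs H\<close>.\<close>
      also have "\<dots> \<le> card (out_cut H S)"
        using S'(2) by (intro card_mono) (auto simp: out_eq)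
      finally show ?thesis
        by (simp add: S(2))
    qed
    show "connectivity_preserver k H G"
      unfolding connectivity_preserver_def
    proof (intro ballI antisym)
      fix s t assume st: "s \<in> verts G" "t \<in> verts G"
      show "sym_conn_upto k H s t \<le> sym_conn_upto k G s t"
        unfolding sym_conn_upto_def sym_conn_def
        by (intro min.mono G.flow_mono_subgraph sub order_refl)
      show "sym_conn_upto k G s t \<le> sym_conn_upto k H s t"
        using flow_ge[OF st] flow_ge[OF st(2,1)] sym_conn_upto_commute[of k G s t]
        by (simp add: sym_conn_upto_def sym_conn_def)
    qed
  qed
qed

end
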